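(* For every $(\lambda,K,\varepsilon,\beta)\in T_0=[0,1)\times[1,\infty)\times(0,1]\times(0,1]$, \[ \rho^{(N)}_{\mathrm{opt}}(\lambda,K,\varepsilon,\beta)\;\ge\;\max\{\lambda,(1-\varepsilon)^{1/\alpha}\}\,1_{\varepsilon<1}+\lambda\,1_{\varepsilon=1}, \] where (for $\varepsilon<1$) \[ \alpha=\left\lfloor\frac{\log[(K-\varepsilon)/(1-\varepsilon)]+\log\lambda^{-1}}{\log\lambda^{-1}}\right\rfloor , \] and when $\varepsilon\in(0,1)$ and $\lambda=0$ the quantity inside the floor is interpreted as $1$ (so $\alpha=1$).
   Context: An Mtk (Markov transition kernel) is a Markov transition kernel $P:\mathsf X\times\mathcal B\to[0,1]$ on a countably generated measurable space $(\mathsf X,\mathcal B)$. Write $Pf(x)=\int_{\mathsf X}P(x,\mathrm dy)f(y)$, $P^m$ for the $m$-step kernel, and $\delta_xP^m=P^m(x,\cdot)$. Total variation distance: $d_{\mathrm{TV}}(\mu,\nu)=\sup_{A\in\mathcal B}[\mu(A)-\nu(A)]$. If $P$ has stationary probability measure $\Pi$, its convergence rate is \[ \rho_*(P)=\exp\Big[\sup_{x\in\mathsf X}\limsup_{m\to\infty}\frac{\log d_{\mathrm{TV}}(\delta_xP^m,\Pi)}{m}\Big]\in[0,1] \] (with $\log 0=-\infty$, $\exp(-\infty)=0$). $P$ satisfies (A1)-(A3) with parameter $(\lambda,K,\varepsilon,\beta)\in T_0$ if there are $C\in\mathcal B$, a measurable $V:\mathsf X\to[1,\infty)$ and a probability measure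 $\nu$ on $\mathcal B$ such that: (A1) $PV(x)\le\lambda V(x)1_{\mathsf X\setminus C}(x)+K1_C(x)$ for all $x\in\mathsf X$; (A2) $P(x,A)\ge\varepsilon\nu(A)$ for all $x\in C$, $A\in\mathcal B$; (A3) $\nu(C)\ge\beta$. It is known that (A1)-(A3) imply that $P$ has a unique stationary distribution $\Pi$. $P$ is reversible if $\int g\,Pf\,\mathrm d\Pi=\int f\,Pg\,\mathrm d\Pi$ for all $f,g\in L^2(\Pi)$, and non-negative definite if $\int f\,Pf\,\mathrm d\Pi\ge0$ for all $f\in L^2(\Pi)$. $S^{(N)}_{\lambda,K,\varepsilon,\beta}$ denotes the collection of all reversible and non-negative definite Mtks satisfying (A1)-(A3) with parameter $(\lambda,K,\varepsilon,\beta)$; the state space is not fixed and may vary from kernel to kernel. (For set-theoretic reasons, the state spaces are taken from some fixed set of measurable spaces; the only requirement is that $S^{(N)}_{\lambda,K,\varepsilon,\beta}$ contains at least all such Mtks whose state space is a finite set of integers.) Define \[ \rho^{(N)}_{\mathrm{opt}}(\lambda,K,\varepsilon,\beta)=\sup_{P\in S^{(N)}_{\lambda,K,\varepsilon,\beta}}\rho_*(P). \] *)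

theory Defs
  imports "HOL-Probability.Probability"
begin

section \<open>Markov transition kernels\<close>

text \<open>
  A measurable space is represented by a value of type \<open>'a measure\<close>, of which only \<open>space\<close> and
  \<open>sets\<close> are used.
\<close>

definition countably_generated :: "'a measure \<Rightarrow> bool" where
  "countably_generated M \<longleftrightarrow>
     (\<exists>G. countable G \<and> G \<subseteq> Pow (space M) \<and> sets M = sigma_sets (space M) G)"

definition mtk :: "'a measure \<Rightarrow> ('a \<Rightarrow> 'a measure) \<Rightarrow> bool" where
  "mtk M P \<longleftrightarrow> countably_generated M \<and> P \<in> M \<rightarrow>\<^sub>M prob_algebra M"

primrec kernel_pow :: "'a measure \<Rightarrow> ('a \<Rightarrow> 'a measure) \<Rightarrow> nat \<Rightarrow> 'a \<Rightarrow> 'a measure" where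
  "kernel_pow M P 0 x = return M x"
| "kernel_pow M P (Suc m) x = kernel_pow M P m x \<bind> P"

definition kernel_apply :: "('a \<Rightarrow> 'a measure) \<Rightarrow> ('a \<Rightarrow> real) \<Rightarrow> 'a \<Rightarrow> real" where
  "kernel_apply P f x = (\<integral>y. f y \<partial>P x)"

definition stationary :: "'a measure \<Rightarrow> ('a \<Rightarrow> 'a measure) \<Rightarrow> 'a measure \<Rightarrow> bool" where
  "stationary M P \<pi> \<longleftrightarrow> \<pi> \<in> space (prob_algebra M) \<and> \<pi> \<bind> P = \<pi>"

text \<open>
  The stationary distribution; it is meaningful for kernels that have exactly one, which is the
  case under the drift and minorization conditions below.
\<close>

definition stat_dist :: "'a measure \<Rightarrow> ('a \<Rightarrow> 'a measure) \<Rightarrow> 'a measure" where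
  "stat_dist M P = (THE \<pi>. stationary M P \<pi>)"

section \<open>Convergence rate\<close>

definition tv_dist :: "'a measure \<Rightarrow> 'a measure \<Rightarrow> real" where
  "tv_dist \<mu> \<nu> = (SUP A\<in>sets \<mu>. measure \<mu> A - measure \<nu> A)"

definition elog :: "real \<Rightarrow> ereal" where
  "elog x = (if x = 0 then -\<infinity> else ereal (ln x))"

definition eexp :: "ereal \<Rightarrow> ereal" where
  "eexp x = (case x of ereal r \<Rightarrow> ereal (exp r) | PInfty \<Rightarrow> \<infinity> | MInfty \<Rightarrow> 0)"

definition conv_rate :: "'a measure \<Rightarrow> ('a \<Rightarrow> 'a measure) \<Rightarrow> ereal" where
  "conv_rate M P =
     eexp (SUP x\<in>space M.
       limsup (\<lambda>m. elog (tv_dist (kernel_pow M P m x) (stat_dist M P)) / ereal (real m)))"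

section \<open>Drift and minorization\<close>

text \<open>
  In the drift condition, \<open>PV\<close> is the nonnegative Lebesgue integral, so that the condition
  includes the finiteness of \<open>PV\<close>.
\<close>

definition drift_minorization ::
    "'a measure \<Rightarrow> ('a \<Rightarrow> 'a measure) \<Rightarrow> real \<Rightarrow> real \<Rightarrow> real \<Rightarrow> real \<Rightarrow> bool" where
  "drift_minorization M P lam K \<epsilon> \<beta> \<longleftrightarrow>
     (\<exists>C\<in>sets M. \<exists>V\<in>borel_measurable M. \<exists>\<nu>\<in>space (prob_algebra M).
        (\<forall>x\<in>space M. (1::real) \<le> V x) \<and>
        (\<forall>x\<in>space M. (\<integral>\<^sup>+y. ennreal (V y) \<partial>P x)
            \<le> ennreal (lam * V x * indicator (space M - C) x + K * indicator C x)) \<and>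
        (\<forall>x\<in>C. \<forall>A\<in>sets M. measure (P x) A \<ge> \<epsilon> * measure \<nu> A) \<and>
        measure \<nu> C \<ge> \<beta>)"

definition param_space :: "(real \<times> real \<times> real \<times> real) set" where
  "param_space = {0..<1} \<times> {1..} \<times> {0<..1} \<times> {0<..1}"

section \<open>Reversible non-negative definite kernels\<close>

definition L2 :: "'a measure \<Rightarrow> ('a \<Rightarrow> real) set" where
  "L2 \<mu> = {f \<in> borel_measurable \<mu>. integrable \<mu> (\<lambda>x. (f x)\<^sup>2)}"

definition reversible :: "'a measure \<Rightarrow> ('a \<Rightarrow> 'a measure) \<Rightarrow> bool" where
  "reversible M P \<longleftrightarrow>
     (\<forall>f\<in>L2 (stat_dist M P). \<forall>g\<in>L2 (stat_dist M P).
        (\<integral>x. g x * kernel_apply P f x \<partial>stat_dist M P)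
          = (\<integral>x. f x * kernel_apply P g x \<partial>stat_dist M P))"

definition nonneg_definite :: "'a measure \<Rightarrow> ('a \<Rightarrow> 'a measure) \<Rightarrow> bool" where
  "nonneg_definite M P \<longleftrightarrow>
     (\<forall>f\<in>L2 (stat_dist M P). (\<integral>x. f x * kernel_apply P f x \<partial>stat_dist M P) \<ge> 0)"

text \<open>\<open>\<X>\<close> is the set of admissible state spaces.\<close>

definition S_N :: "'a measure set \<Rightarrow> real \<Rightarrow> real \<Rightarrow> real \<Rightarrow> real
    \<Rightarrow> ('a measure \<times> ('a \<Rightarrow> 'a measure)) set" where
  "S_N \<X> lam K \<epsilon> \<beta> =
     {(M, P). M \<in> \<X> \<and> mtk M P \<and> drift_minorization M P lam K \<epsilon> \<beta> \<and>
              reversible M P \<and> nonneg_definite M P}"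

definition rho_opt_N :: "'a measure set \<Rightarrow> real \<Rightarrow> real \<Rightarrow> real \<Rightarrow> real \<Rightarrow> ereal" where
  "rho_opt_N \<X> lam K \<epsilon> \<beta> = (SUP (M, P)\<in>S_N \<X> lam K \<epsilon> \<beta>. conv_rate M P)"

text \<open>
  The case \<open>lam = 0\<close> is separate because \<open>ln\<close> and division are totalized at \<open>0\<close>.
\<close>

definition alpha :: "real \<Rightarrow> real \<Rightarrow> real \<Rightarrow> int" where
  "alpha lam K \<epsilon> =
     (if lam = 0 then 1
      else \<lfloor>(ln ((K - \<epsilon>) / (1 - \<epsilon>)) + ln (1 / lam)) / ln (1 / lam)\<rfloor>)"

end

theory Submission
  imports Defs
begin

text \<open>
  The idea is to make the stationary distribution a point mass. If \<open>s 0\<close> is an absorbing state that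
  every other state reaches, then \<open>\<delta>\<close> at \<open>s 0\<close> is the only stationary distribution, and in its
  \<open>L\<^sup>2\<close> space the kernel acts as the identity. Hence reversibility and non-negative
  definiteness hold whatever the kernel does on the transient states, while the convergence
  rate, a supremum over all starting points, still sees those states: it measures how slowly
  the chain is absorbed.

  Both lower bounds come from one family of such chains. On \<open>s 0, \<dots>, s n\<close> the chain descends
  deterministically from \<open>s n\<close> to \<open>s 1\<close>; there it returns to \<open>s n\<close> with
  probability \<open>q\<close> and is absorbed otherwise. A full turn takes \<open>n\<close> steps and is survived with
  probability \<open>q\<close>, so the rate is at least \<open>q powr (1 / n)\<close> (\<open>conv_rate_ge\<close>).

  \<^item> With \<open>n = 1\<close>, \<open>q < lam\<close> and \<open>C = {s 0}\<close>, a large enough \<open>V (s 1)\<close> gives the drift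
    condition (\<open>drift_minorization_lazy\<close>). Letting \<open>q\<close> increase to \<open>lam\<close> gives the bound \<open>lam\<close>.

  \<^item> With \<open>q = 1 - \<epsilon>\<close> and \<open>C = {s 0, s 1}\<close>, minorization is sharp at \<open>s 1\<close>. The function \<open>V\<close> has to
    shrink by the factor \<open>lam\<close> along each descending step, so the height \<open>n\<close> is limited only by \<open>PV (s 1) = (1 - \<epsilon>) * (1 / lam) ^ (n - 1) + \<epsilon> \<le> K\<close> (\<open>drift_minorization_cycle\<close>).
    The largest \<open>n\<close> allowed is \<open>alpha lam K \<epsilon>\<close> (\<open>alpha_height\<close>).
\<close>

section \<open>Cycles with an absorbing exit\<close>

text \<open>
  The successor of state \<open>j\<close>, where \<open>b\<close> says whether the coin tossed at state \<open>1\<close> allows another turn.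
  Truncated subtraction makes \<open>0\<close> absorbing.
\<close>

definition cycle_next :: "nat \<Rightarrow> bool \<Rightarrow> nat \<Rightarrow> nat" where
  "cycle_next n b j = (if j = 1 \<and> b then n else j - 1)"

definition cycle_kernel ::
    "'a measure \<Rightarrow> (nat \<Rightarrow> 'a) \<Rightarrow> nat \<Rightarrow> real \<Rightarrow> 'a \<Rightarrow> 'a measure" where
  "cycle_kernel M s n q x =
     distr (measure_pmf (bernoulli_pmf q)) M (\<lambda>b. s (cycle_next n b (inv_into {..n} s x)))"

locale absorbing_cycle =
  fixes M :: "'a measure" and s :: "nat \<Rightarrow> 'a" and n :: nat and q :: real
  assumes sets_M: "sets M = Pow (s ` {..n})"
    and inj_s: "inj_on s {..n}"
    and n_pos: "1 \<le> n"
    and q_nonneg: "0 \<le> q" and q_less_1: "q < 1"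
begin

abbreviation P :: "'a \<Rightarrow> 'a measure" where
  "P \<equiv> cycle_kernel M s n q"

lemma space_M: "space M = s ` {..n}"
  using sets_eq_imp_space_eq[of M "count_space (s ` {..n})"] sets_M by simp

lemma s_in_space: "j \<le> n \<Longrightarrow> s j \<in> space M"
  by (simp add: space_M)

lemma s_eq_iff: "i \<le> n \<Longrightarrow> j \<le> n \<Longrightarrow> s i = s j \<longleftrightarrow> i = j"
  using inj_s by (auto simp: inj_on_def)

lemma inv_s: "j \<le> n \<Longrightarrow> inv_into {..n} s (s j) = j"
  using inj_s by (simp add: inv_into_f_f)

lemma next_le: "j \<le> n \<Longrightarrow> cycle_next n b j \<le> n"
  by (auto simp: cycle_next_def)

lemma sets_M_count_space: "sets M = sets (count_space (space M))"
  by (simp add: sets_M space_M)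

lemma measurable_from_M: "f \<in> M \<rightarrow>\<^sub>M N \<longleftrightarrow> f \<in> space M \<rightarrow> space N"
  by (subst measurable_cong_sets[OF sets_M_count_space refl]) (rule measurable_count_space_eq1)

lemma borel_measurable_M: "f \<in> borel_measurable M"
  by (simp add: measurable_from_M)

lemma in_sets_M: "A \<subseteq> space M \<Longrightarrow> A \<in> sets M"
  by (simp add: sets_M space_M)

lemma P_apply: "j \<le> n \<Longrightarrow>
    P (s j) = distr (measure_pmf (bernoulli_pmf q)) M (\<lambda>b. s (cycle_next n b j))"
  by (simp add: cycle_kernel_def inv_s)

lemma step_measurable:
  "j \<le> n \<Longrightarrow> (\<lambda>b. s (cycle_next n b j)) \<in> measure_pmf (bernoulli_pmf q) \<rightarrow>\<^sub>M M"
  by (auto intro!: s_in_space next_le)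

lemma nn_integral_P:
  assumes "j \<le> n"
  shows "(\<integral>\<^sup>+y. f y \<partial>P (s j)) =
    f (s (cycle_next n True j)) * ennreal q + f (s (cycle_next n False j)) * ennreal (1 - q)"
  using assms q_nonneg q_less_1
  by (simp add: P_apply nn_integral_distr[OF step_measurable] borel_measurable_M)

lemma integral_P:
  fixes f :: "'a \<Rightarrow> real"
  assumes "j \<le> n"
  shows "(\<integral>y. f y \<partial>P (s j)) =
    f (s (cycle_next n True j)) * q + f (s (cycle_next n False j)) * (1 - q)"
  using assms q_nonneg q_less_1
  by (simp add: P_apply integral_distr[OF step_measurable] borel_measurable_M)

lemma sets_P: "sets (P x) = sets M"
  by (simp add: cycle_kernel_def)

lemma space_P: "space (P x) = space M"
  by (simp add: cycle_kernel_def)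

lemma emeasure_P:
  assumes "j \<le> n" "A \<in> sets M"
  shows "emeasure (P (s j)) A =
    indicator A (s (cycle_next n True j)) * ennreal q
      + indicator A (s (cycle_next n False j)) * ennreal (1 - q)"
  using nn_integral_P[OF assms(1), of "indicator A"] assms(2) by (simp add: sets_P)

lemma prob_space_P: "j \<le> n \<Longrightarrow> prob_space (P (s j))"
  unfolding P_apply
  by (rule prob_space.prob_space_distr[OF prob_space_measure_pmf step_measurable])

lemma P_measurable: "P \<in> M \<rightarrow>\<^sub>M prob_algebra M"
  by (auto simp: measurable_from_M space_prob_algebra sets_P prob_space_P space_M)

lemma P_measurable': "P \<in> M \<rightarrow>\<^sub>M subprob_algebra M"
  by (rule measurable_prob_algebraD[OF P_measurable])

lemma mtk_P: "mtk M P"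
  unfolding mtk_def countably_generated_def
proof (intro conjI exI[of _ "sets M"])
  show "countable (sets M)"
    by (simp add: sets_M countable_finite)
qed (simp_all add: sets.space_closed sets.sigma_sets_eq P_measurable)

abbreviation \<delta> :: "'a measure" where
  "\<delta> \<equiv> return M (s 0)"

lemma prob_\<delta>: "\<delta> \<in> space (prob_algebra M)"
  by (simp add: space_prob_algebra prob_space_return s_in_space)

lemma P_absorbing: "P (s 0) = \<delta>"
proof (rule measure_eqI)
  fix A assume "A \<in> sets (P (s 0))"
  then have A: "A \<in> sets M" by (simp add: sets_P)
  have "ennreal q + ennreal (1 - q) = 1"
    using q_nonneg q_less_1 by (simp flip: ennreal_plus)
  then show "emeasure (P (s 0)) A = emeasure \<delta> A"
    using A by (simp add: emeasure_P cycle_next_def flip: distrib_left)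
qed (simp add: sets_P)

text \<open>One-step lower bound: among all paths into \<open>A\<close>, count those through the state \<open>s j\<close> only.\<close>

lemma emeasure_bind_ge:
  assumes \<mu>: "sets \<mu> = sets M" and j: "j \<le> n" and A: "A \<in> sets M"
  shows "emeasure (\<mu> \<bind> P) A \<ge> emeasure \<mu> {s j} * emeasure (P (s j)) A"
proof -
  have sp: "space \<mu> = space M"
    using \<mu> by (rule sets_eq_imp_space_eq)
  have meas: "P \<in> \<mu> \<rightarrow>\<^sub>M subprob_algebra M"
    using P_measurable' measurable_cong_sets[OF \<mu> refl] by blast
  have "emeasure (\<mu> \<bind> P) A = (\<integral>\<^sup>+x. emeasure (P x) A \<partial>\<mu>)"
    by (rule emeasure_bind[OF _ meas A]) (use s_in_space[OF j] sp in auto)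
  also have "\<dots> \<ge> (\<integral>\<^sup>+x. emeasure (P (s j)) A * indicator {s j} x \<partial>\<mu>)"
    by (rule nn_integral_mono) (auto simp: indicator_def)
  also have "(\<integral>\<^sup>+x. emeasure (P (s j)) A * indicator {s j} x \<partial>\<mu>)
      = emeasure (P (s j)) A * emeasure \<mu> {s j}"
    by (rule nn_integral_cmult_indicator) (simp add: \<mu> in_sets_M s_in_space j)
  finally show ?thesis by (simp add: mult.commute)
qed

text \<open>
  Mass flows into \<open>s 0\<close> from \<open>s 1\<close> and never leaves, so \<open>s 1\<close> is null; every state that feeds a null
  state is null, and the descent from \<open>s n\<close> propagates this to all transient states.
\<close>

lemma stationary_unique:
  assumes "stationary M P \<pi>"
  shows "\<pi> = \<delta>"
proof -
  have sets: "sets \<pi> = sets M" and prob: "prob_space \<pi>" and inv: "\<pi> \<bind> P = \<pi>"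
    using assms by (auto simp: stationary_def space_prob_algebra)
  interpret \<pi>: prob_space \<pi> by (rule prob)
  have sp: "space \<pi> = space M"
    using sets by (rule sets_eq_imp_space_eq)
  have meas: "P \<in> \<pi> \<rightarrow>\<^sub>M subprob_algebra M"
    using P_measurable' measurable_cong_sets[OF sets refl] by blast
  have sing: "{s j} \<in> sets \<pi>" if "j \<le> n" for j
    using that by (simp add: sets in_sets_M s_in_space)
  have null_1: "emeasure \<pi> {s 1} = 0"
  proof -
    \<comment> \<open>Mass balance at \<open>s 0\<close>: it keeps all it has and receives the share \<open>1 - q\<close> of the mass at \<open>s 1\<close>.\<close>
    have "emeasure \<pi> {s 0} + emeasure \<pi> {s 1} * ennreal (1 - q)
        = (\<integral>\<^sup>+x. indicator {s 0} x + ennreal (1 - q) * indicator {s 1} x \<partial>\<pi>)"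
      using n_pos sing[of 0] sing[of 1]
      by (simp add: nn_integral_add nn_integral_cmult_indicator mult.commute)
    also have "\<dots> \<le> (\<integral>\<^sup>+x. emeasure (P x) {s 0} \<partial>\<pi>)"
    proof (rule nn_integral_mono)
      fix x assume "x \<in> space \<pi>"
      then obtain j where "j \<le> n" "x = s j" by (auto simp: sp space_M)
      then show "indicator {s 0} x + ennreal (1 - q) * indicator {s 1} x \<le> emeasure (P x) {s 0}"
        using n_pos by (cases "j = 0"; cases "j = 1")
          (auto simp: P_absorbing emeasure_P in_sets_M s_in_space s_eq_iff cycle_next_def)
    qed
    also have "\<dots> = emeasure (\<pi> \<bind> P) {s 0}"
      by (rule emeasure_bind[OF _ meas, symmetric])
        (use s_in_space[of 0] sp in \<open>auto simp: in_sets_M\<close>)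
    also have "\<dots> = emeasure \<pi> {s 0}"
      by (simp add: inv)
    finally have "emeasure \<pi> {s 0} + emeasure \<pi> {s 1} * ennreal (1 - q) \<le> emeasure \<pi> {s 0} + 0"
      by simp
    then have "emeasure \<pi> {s 1} * ennreal (1 - q) \<le> 0"
      by (subst (asm) ennreal_add_left_cancel_le) simp
    then show ?thesis
      using q_less_1 by simp
  qed
  have null: "emeasure \<pi> {s (Suc i)} = 0" if "Suc i \<le> n" for i
    using that
  proof (induction i)
    case 0
    then show ?case using null_1 by simp
  next
    case (Suc i)
    have "emeasure (P (s (Suc (Suc i)))) {s (Suc i)} = ennreal q + ennreal (1 - q)"
      using Suc.prems by (simp add: emeasure_P in_sets_M s_in_space cycle_next_def)
    also have "\<dots> = 1"
      using q_nonneg q_less_1 by (simp flip: ennreal_plus)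
    finally show ?case
      using emeasure_bind_ge[OF sets Suc.prems, of "{s (Suc i)}"] Suc
      by (simp add: inv in_sets_M s_in_space)
  qed
  have ae: "AE x in \<pi>. x = s 0"
  proof (rule AE_I')
    show "(\<Union>i\<in>{..<n}. {s (Suc i)}) \<in> null_sets \<pi>"
      by (rule null_sets_UN') (auto simp: null_sets_def null sing)
    show "{x \<in> space \<pi>. x \<noteq> s 0} \<subseteq> (\<Union>i\<in>{..<n}. {s (Suc i)})"
    proof
      fix x assume "x \<in> {x \<in> space \<pi>. x \<noteq> s 0}"
      then obtain j where j: "j \<le> n" "x = s j" "j \<noteq> 0" by (auto simp: sp space_M)
      then have "x = s (Suc (j - 1))" "j - 1 < n" by auto
      then show "x \<in> (\<Union>i\<in>{..<n}. {s (Suc i)})" by blast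
    qed
  qed
  show ?thesis
  proof (rule measure_eqI)
    fix A assume A: "A \<in> sets \<pi>"
    have "emeasure \<pi> A = (\<integral>\<^sup>+x. indicator A x \<partial>\<pi>)"
      using A by simp
    also have "\<dots> = (\<integral>\<^sup>+x. indicator A (s 0) \<partial>\<pi>)"
      by (rule nn_integral_cong_AE) (use ae in auto)
    finally show "emeasure \<pi> A = emeasure \<delta> A"
      using A by (simp add: \<pi>.emeasure_space_1 sets)
  qed (simp add: sets)
qed

lemma stat_dist_P: "stat_dist M P = \<delta>"
  unfolding stat_dist_def
proof (rule the_equality)
  have "\<delta> \<bind> P = P (s 0)"
    by (rule bind_return[OF P_measurable' s_in_space]) simp
  then show "stationary M P \<delta>"
    by (simp add: stationary_def prob_\<delta> P_absorbing)
qed (rule stationary_unique)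

lemma integral_\<delta>:
  fixes f :: "'a \<Rightarrow> real"
  shows "(\<integral>x. f x \<partial>\<delta>) = f (s 0)"
  by (rule integral_return[OF s_in_space borel_measurable_M]) simp

lemma kernel_apply_absorbing: "kernel_apply P f (s 0) = f (s 0)"
  by (simp add: kernel_apply_def P_absorbing integral_\<delta>)

lemma reversible_P: "reversible M P"
  by (simp add: reversible_def stat_dist_P integral_\<delta> kernel_apply_absorbing mult.commute)

lemma nonneg_definite_P: "nonneg_definite M P"
  by (simp add: nonneg_definite_def stat_dist_P integral_\<delta> kernel_apply_absorbing)

section \<open>The rate of absorption\<close>

lemma sets_kernel_pow: "x \<in> space M \<Longrightarrow> sets (kernel_pow M P m x) = sets M"
proof (induction m)
  case (Suc m)
  then have "space (kernel_pow M P m x) = space M"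
    using sets_eq_imp_space_eq by blast
  with Suc show ?case
    by (auto simp: sets_P intro!: sets_bind)
qed simp

lemma kernel_pow_prob:
  "x \<in> space M \<Longrightarrow> kernel_pow M P m x \<in> space (prob_algebra M)"
proof (induction m)
  case 0
  then show ?case by (simp add: space_prob_algebra prob_space_return)
next
  case (Suc m)
  then show ?case
    using measurable_space[OF measurable_bind_prob_space2,
      of "\<lambda>_. kernel_pow M P m x" "count_space UNIV" M "\<lambda>_. P" M] P_measurable
    by simp
qed

text \<open>
  Started at \<open>s n\<close>, the unabsorbed chain has a deterministic position, and by time \<open>m\<close> it has passed
  the coin toss exactly \<open>m div n\<close> times.
\<close>

lemma kernel_pow_ge:
  "emeasure (kernel_pow M P m (s n)) {s (n - m mod n)} \<ge> ennreal (q ^ (m div n))"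
proof (induction m)
  case 0
  then show ?case by (simp add: in_sets_M s_in_space)
next
  case (Suc m)
  let ?\<mu> = "kernel_pow M P m (s n)" and ?j = "n - m mod n" and ?j' = "n - Suc m mod n"
  have n: "0 < n" using n_pos by simp
  have step: "emeasure (P (s ?j)) {s ?j'} \<ge> ennreal (q ^ (Suc m div n - m div n))"
  proof (cases "Suc (m mod n) = n")
    case True
    then have "?j = 1" "?j' = n" "Suc m div n - m div n = 1"
      by (auto simp: mod_Suc div_Suc)
    then show ?thesis
      using n_pos by (auto simp: emeasure_P in_sets_M s_in_space cycle_next_def)
  next
    case False
    have "m mod n < n" using n by simp
    with False have j: "?j \<noteq> 1" "?j' = ?j - 1" "Suc m div n - m div n = 0"
      by (auto simp: mod_Suc div_Suc)
    have "emeasure (P (s ?j)) {s ?j'} = ennreal q + ennreal (1 - q)"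
      using j(1) unfolding j(2) by (simp add: emeasure_P in_sets_M s_in_space cycle_next_def)
    also have "\<dots> = 1"
      using q_nonneg q_less_1 by (simp flip: ennreal_plus)
    finally show ?thesis using j by simp
  qed
  have "m div n \<le> Suc m div n" by (simp add: div_le_mono)
  then have "ennreal (q ^ (Suc m div n))
      = ennreal (q ^ (m div n)) * ennreal (q ^ (Suc m div n - m div n))"
    using q_nonneg by (simp flip: ennreal_mult power_add)
  also have "\<dots> \<le> emeasure ?\<mu> {s ?j} * emeasure (P (s ?j)) {s ?j'}"
    by (rule mult_mono[OF Suc.IH step]) auto
  also have "\<dots> \<le> emeasure (?\<mu> \<bind> P) {s ?j'}"
    by (rule emeasure_bind_ge) (auto simp: sets_kernel_pow in_sets_M s_in_space)
  finally show ?case by simp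
qed

lemma tv_dist_ge:
  "tv_dist (kernel_pow M P m (s n)) (stat_dist M P) \<ge> q ^ (m div n)"
proof -
  let ?\<mu> = "kernel_pow M P m (s n)" and ?A = "{s (n - m mod n)}"
  interpret \<mu>: prob_space ?\<mu>
    using kernel_pow_prob[OF s_in_space[of n]] by (simp add: space_prob_algebra)
  have A: "?A \<in> sets M" by (simp add: in_sets_M s_in_space)
  have "m mod n < n" using n_pos by simp
  then have "measure \<delta> ?A = 0"
    using A by (simp add: measure_return s_eq_iff)
  moreover have "q ^ (m div n) \<le> measure ?\<mu> ?A"
    using kernel_pow_ge[of m] by (simp add: \<mu>.emeasure_eq_measure)
  moreover have "measure ?\<mu> ?A - measure \<delta> ?A \<le> tv_dist ?\<mu> \<delta>"
    unfolding tv_dist_def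
  proof (rule cSUP_upper)
    show "?A \<in> sets ?\<mu>" using A by (simp add: sets_kernel_pow s_in_space)
    have "measure ?\<mu> B - measure \<delta> B \<le> 1" for B
      using \<mu>.prob_le_1[of B] measure_nonneg[of \<delta> B] by linarith
    then show "bdd_above ((\<lambda>B. measure ?\<mu> B - measure \<delta> B) ` sets ?\<mu>)"
      by (intro bdd_aboveI2)
  qed
  ultimately show ?thesis by (simp add: stat_dist_P)
qed

lemma conv_rate_ge: "conv_rate M P \<ge> ereal (q powr (1 / real n))"
proof (cases "q = 0")
  case True
  then show ?thesis
    by (simp add: conv_rate_def eexp_def zero_ereal_def[symmetric] split: ereal.split)
next
  case False
  with q_nonneg have q: "0 < q" by simp
  let ?d = "\<lambda>m. tv_dist (kernel_pow M P m (s n)) (stat_dist M P)"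
  have bound: "elog (?d m) / ereal (real m) \<ge> ereal (ln q / real n)" if m: "0 < m" for m
  proof -
    have d: "q ^ (m div n) \<le> ?d m" by (rule tv_dist_ge)
    have pos: "0 < q ^ (m div n)" using q by simp
    with d have d_pos: "0 < ?d m" by linarith
    have "real (m div n) \<le> real m / real n"
      by (rule of_nat_div_le_of_nat)
    then have "real m * (ln q / real n) \<le> real (m div n) * ln q"
      using mult_right_mono_neg[of "real (m div n)" "real m / real n" "ln q"] q q_less_1 by simp
    also have "\<dots> \<le> ln (?d m)"
      using ln_mono[OF d pos] q by (simp add: ln_realpow)
    finally show ?thesis
      using m d_pos by (simp add: elog_def le_divide_eq mult.commute)
  qed
  have "ereal (ln q / real n) \<le> limsup (\<lambda>m. elog (?d m) / ereal (real m))"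
    by (rule order_trans[OF Liminf_bounded Liminf_le_Limsup])
      (auto intro!: eventually_mono[OF eventually_gt_at_top[of 0] bound])
  also have "\<dots> \<le> (SUP x\<in>space M. limsup (\<lambda>m.
      elog (tv_dist (kernel_pow M P m x) (stat_dist M P)) / ereal (real m)))"
    by (rule SUP_upper[OF s_in_space]) simp
  finally have "eexp (SUP x\<in>space M. limsup (\<lambda>m.
      elog (tv_dist (kernel_pow M P m x) (stat_dist M P)) / ereal (real m)))
      \<ge> ereal (exp (ln q / real n))"
    unfolding eexp_def by (auto split: ereal.split)
  then show ?thesis
    using q by (simp add: conv_rate_def powr_def)
qed

section \<open>Drift and minorization\<close>

lemma measure_P:
  assumes "j \<le> n" "A \<in> sets M"
  shows "measure (P (s j)) A =
    indicator A (s (cycle_next n True j)) * q + indicator A (s (cycle_next n False j)) * (1 - q)"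
  using integral_P[OF assms(1), of "indicator A"] assms(2) sets.sets_into_space[OF assms(2)]
  by (simp add: space_P Int_absorb2)

text \<open>
  Both choices of \<open>C\<close> contain \<open>s 0\<close> and use \<open>\<nu> = \<delta>\<close>, so everything reduces to inequalities for the
  values \<open>w j\<close> of \<open>V\<close> and, where \<open>C\<close> also contains \<open>s 1\<close>, to \<open>\<epsilon> \<le> 1 - q\<close>.
\<close>

lemma drift_minorizationI:
  fixes w :: "nat \<Rightarrow> real"
  assumes J: "J \<subseteq> {0, 1}" "0 \<in> J"
    and w: "\<And>j. j \<le> n \<Longrightarrow> 1 \<le> w j"
    and drift: "\<And>j. j \<le> n \<Longrightarrow> w (cycle_next n True j) * q + w (cycle_next n False j) * (1 - q)
        \<le> (if j \<in> J then K else lam * w j)"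
    and \<epsilon>: "0 \<le> \<epsilon>" "\<epsilon> \<le> 1" "1 \<in> J \<Longrightarrow> \<epsilon> \<le> 1 - q" and \<beta>: "\<beta> \<le> 1"
  shows "drift_minorization M P lam K \<epsilon> \<beta>"
proof -
  let ?V = "\<lambda>x. w (inv_into {..n} s x)" and ?C = "s ` J"
  have J_le: "J \<subseteq> {..n}" using J n_pos by auto
  have C: "?C \<in> sets M" using J_le by (auto intro!: in_sets_M s_in_space)
  have in_C: "s j \<in> ?C \<longleftrightarrow> j \<in> J" if "j \<le> n" for j
    using that J_le inj_s by (auto simp: inj_on_def)
  show ?thesis
    unfolding drift_minorization_def
  proof (intro bexI[of _ ?C] bexI[of _ ?V] bexI[of _ \<delta>] conjI)
    show "\<forall>x\<in>space M. 1 \<le> ?V x"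
      using w by (auto simp: space_M inv_s)
    show "\<forall>x\<in>space M. (\<integral>\<^sup>+y. ennreal (?V y) \<partial>P x)
        \<le> ennreal (lam * ?V x * indicator (space M - ?C) x + K * indicator ?C x)"
    proof
      fix x assume "x \<in> space M"
      then obtain j where j: "j \<le> n" and x: "x = s j" by (auto simp: space_M)
      have nonneg: "0 \<le> w (cycle_next n b j)" for b
        using w[OF next_le[OF j]] by (meson order_trans zero_le_one)
      have "(\<integral>\<^sup>+y. ennreal (?V y) \<partial>P x)
          = ennreal (w (cycle_next n True j) * q + w (cycle_next n False j) * (1 - q))"
        using j nonneg q_nonneg q_less_1
        by (simp add: x nn_integral_P inv_s next_le ennreal_mult)
      also have "\<dots> \<le> ennreal (lam * ?V x * indicator (space M - ?C) x + K * indicator ?C x)"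
        by (rule ennreal_leI)
        (use drift[OF j] j in \<open>auto simp: x in_C inv_s s_in_space indicator_def\<close>)
      finally show "(\<integral>\<^sup>+y. ennreal (?V y) \<partial>P x)
          \<le> ennreal (lam * ?V x * indicator (space M - ?C) x + K * indicator ?C x)" .
    qed
    show "\<forall>x\<in>?C. \<forall>A\<in>sets M. measure (P x) A \<ge> \<epsilon> * measure \<delta> A"
    proof safe
      fix j A assume j: "j \<in> J" and A: "A \<in> sets M"
      consider "j = 0" | "j = 1" using j J by auto
      then show "measure (P (s j)) A \<ge> \<epsilon> * measure \<delta> A"
      proof cases
        case 1
        then show ?thesis
          using \<epsilon> by (simp add: P_absorbing mult_left_le_one_le)
      next
        case 2
        then show ?thesis
          using \<epsilon>(3) j q_nonneg n_pos A
          by (auto simp: measure_P measure_return cycle_next_def indicator_def)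
      qed
    qed
    show "measure \<delta> ?C \<ge> \<beta>"
      using \<beta> J C by (simp add: measure_return)
  qed (auto simp: C borel_measurable_M prob_\<delta>)
qed

text \<open>
  The value of \<open>V\<close> at \<open>s 1\<close> solves \<open>q * V + (1 - q) = lam * V\<close>, which turns the drift condition there
  into an equality.
\<close>

lemma drift_minorization_lazy:
  assumes "n = 1" "q < lam" "lam < 1" "1 \<le> K" "0 \<le> \<epsilon>" "\<epsilon> \<le> 1" "\<beta> \<le> 1"
  shows "drift_minorization M P lam K \<epsilon> \<beta>"
proof (rule drift_minorizationI)
  let ?v = "(1 - q) / (lam - q)"
  let ?w = "\<lambda>j::nat. if j = 0 then 1 else ?v"
  fix j assume "j \<le> n"
  then consider "j = 0" | "j = 1" using assms(1) by linarith
  then show "?w (cycle_next n True j) * q + ?w (cycle_next n False j) * (1 - q)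
      \<le> (if j \<in> {0} then K else lam * ?w j)"
  proof cases
    case 1
    then show ?thesis using assms by (simp add: cycle_next_def)
  next
    case 2
    have "(lam - q) * ?v = 1 - q" using assms by simp
    with 2 show ?thesis
      using assms
      by (simp add: cycle_next_def algebra_simps
        del: times_divide_eq_left times_divide_eq_right)
  qed
qed (use assms in auto)

text \<open>
  The condition on \<open>lam = 0\<close> reflects that a drift to \<open>0\<close> leaves no room for states outside \<open>C\<close>.
\<close>

lemma drift_minorization_cycle:
  assumes q: "q = 1 - \<epsilon>" and height: "(1 - \<epsilon>) * (1 / lam) ^ (n - 1) + \<epsilon> \<le> K"
    and lam: "0 \<le> lam" "lam < 1" "lam = 0 \<Longrightarrow> n = 1"
    and K: "1 \<le> K" and \<epsilon>: "0 < \<epsilon>" "\<epsilon> \<le> 1" and \<beta>: "\<beta> \<le> 1"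
  shows "drift_minorization M P lam K \<epsilon> \<beta>"
proof (rule drift_minorizationI)
  let ?w = "\<lambda>j::nat. (1 / lam) ^ (j - 1)"
  fix j assume j: "j \<le> n"
  show "1 \<le> ?w j"
    using lam j by (cases "lam = 0") (auto intro!: one_le_power)
  consider "j = 0" | "j = 1" | i where "j = Suc (Suc i)"
    by (metis One_nat_def not0_implies_Suc)
  then show "?w (cycle_next n True j) * q + ?w (cycle_next n False j) * (1 - q)
      \<le> (if j \<in> {0, 1} then K else lam * ?w j)"
  proof cases
    case 1
    then show ?thesis using K by (simp add: cycle_next_def)
  next
    case 2
    then show ?thesis using height q by (simp add: cycle_next_def mult.commute)
  next
    case 3
    then have "lam \<noteq> 0" using lam j by auto
    with 3 show ?thesis by (simp add: cycle_next_def flip: distrib_left)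
  qed
qed (use q \<epsilon> \<beta> in auto)

lemma rho_opt_N_ge:
  assumes "M \<in> \<X>" "drift_minorization M P lam K \<epsilon> \<beta>"
  shows "ereal (q powr (1 / real n)) \<le> rho_opt_N \<X> lam K \<epsilon> \<beta>"
  unfolding rho_opt_N_def
proof (rule SUP_upper2)
  show "(M, P) \<in> S_N \<X> lam K \<epsilon> \<beta>"
    using assms by (simp add: S_N_def mtk_P reversible_P nonneg_definite_P)
qed (simp add: conv_rate_ge)

end

section \<open>The lower bounds\<close>

lemma absorbing_cycle_exists:
  fixes \<X> :: "'a measure set" and emb :: "int \<Rightarrow> 'a" and q :: real
  assumes inj: "inj emb"
    and rich: "\<And>I. finite I \<Longrightarrow> I \<noteq> {} \<Longrightarrow> \<exists>M\<in>\<X>. sets M = Pow (emb ` I)"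
    and "1 \<le> n" "0 \<le> q" "q < 1"
  obtains M where "M \<in> \<X>" "absorbing_cycle M (\<lambda>j. emb (int j)) n q"
proof -
  obtain M where M: "M \<in> \<X>" "sets M = Pow (emb ` int ` {..n})"
    using rich[of "int ` {..n}"] by auto
  have "absorbing_cycle M (\<lambda>j. emb (int j)) n q"
    using assms M by unfold_locales (auto simp: image_image inj_on_def dest: injD[OF inj])
  with M show thesis using that by blast
qed

text \<open>
  Unfolding the floor, \<open>alpha lam K \<epsilon> - 1\<close> is the largest number of factors \<open>1 / lam\<close> that stays below
  \<open>(K - \<epsilon>) / (1 - \<epsilon>)\<close>.
\<close>

lemma alpha_height:
  assumes lam: "0 \<le> lam" "lam < 1" and K: "1 \<le> K" and \<epsilon>: "0 < \<epsilon>" "\<epsilon> < 1"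
  obtains n where "alpha lam K \<epsilon> = int n" "1 \<le> n" "lam = 0 \<Longrightarrow> n = 1"
    "(1 - \<epsilon>) * (1 / lam) ^ (n - 1) + \<epsilon> \<le> K"
proof (cases "lam = 0")
  case True
  then show thesis using that[of 1] K by (simp add: alpha_def)
next
  case False
  define R where "R = (K - \<epsilon>) / (1 - \<epsilon>)"
  define l where "l = ln (1 / lam)"
  have l: "0 < l" using False lam by (simp add: l_def)
  have R: "1 \<le> R" using K \<epsilon> by (simp add: R_def)
  have a: "alpha lam K \<epsilon> = \<lfloor>(ln R + l) / l\<rfloor>"
    using False by (simp add: alpha_def R_def l_def)
  have "1 \<le> (ln R + l) / l" using l R by simp
  then have a1: "1 \<le> alpha lam K \<epsilon>" by (simp add: a)
  define n where "n = nat (alpha lam K \<epsilon>)"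
  have n: "alpha lam K \<epsilon> = int n" "1 \<le> n" using a1 by (auto simp: n_def)
  have "real n \<le> (ln R + l) / l" using n a by linarith
  then have "real n * l \<le> ln R + l" using l by (simp add: le_divide_eq)
  then have "real (n - 1) * l \<le> ln R" using n by (simp add: of_nat_diff algebra_simps)
  then have "ln ((1 / lam) ^ (n - 1)) \<le> ln R"
    using False lam by (simp add: ln_realpow l_def)
  then have "(1 / lam) ^ (n - 1) \<le> R"
    using False lam R by (subst (asm) ln_le_cancel_iff) auto
  then have "(1 - \<epsilon>) * (1 / lam) ^ (n - 1) \<le> K - \<epsilon>"
    using \<epsilon> by (simp add: R_def le_divide_eq mult.commute)
  with n False show thesis using that[of n] by simp
qed

theorem theorem5:
  fixes \<X> :: "'a measure set" and emb :: "int \<Rightarrow> 'a"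
    and lam K \<epsilon> \<beta> :: real
  assumes "inj emb"
    and "\<And>I. finite I \<Longrightarrow> I \<noteq> {} \<Longrightarrow> \<exists>M\<in>\<X>. sets M = Pow (emb ` I)"
    and "(lam, K, \<epsilon>, \<beta>) \<in> param_space"
  shows "rho_opt_N \<X> lam K \<epsilon> \<beta> \<ge>
    ereal (if \<epsilon> < 1 then max lam ((1 - \<epsilon>) powr (1 / real_of_int (alpha lam K \<epsilon>))) else lam)"
proof -
  have lam: "0 \<le> lam" "lam < 1" and K: "1 \<le> K" and \<epsilon>: "0 < \<epsilon>" "\<epsilon> \<le> 1"
    and \<beta>: "\<beta> \<le> 1"
    using assms(3) by (auto simp: param_space_def)
  have cycle: "ereal ((1 - \<epsilon>) powr (1 / real n)) \<le> rho_opt_N \<X> lam K \<epsilon> \<beta>"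
    if n: "1 \<le> n" "lam = 0 \<Longrightarrow> n = 1" "(1 - \<epsilon>) * (1 / lam) ^ (n - 1) + \<epsilon> \<le> K" for n
  proof -
    obtain M where "M \<in> \<X>" "absorbing_cycle M (\<lambda>j. emb (int j)) n (1 - \<epsilon>)"
      using absorbing_cycle_exists[OF assms(1,2) n(1), of "1 - \<epsilon>"] \<epsilon> by auto
    then show ?thesis
      using n lam K \<epsilon> \<beta>
      by (intro absorbing_cycle.rho_opt_N_ge absorbing_cycle.drift_minorization_cycle) auto
  qed
  have lazy: "ereal lam \<le> rho_opt_N \<X> lam K \<epsilon> \<beta>"
  proof (cases "lam = 0")
    case True
    \<comment> \<open>No \<open>q\<close> lies below \<open>lam\<close>. Rates are nonnegative, but the supremum over an empty class would be
      \<open>-\<infinity>\<close>; the cycle of height \<open>1\<close> shows that the class is inhabited.\<close>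
    have "ereal 0 \<le> ereal ((1 - \<epsilon>) powr (1 / real 1))" by simp
    also have "\<dots> \<le> rho_opt_N \<X> lam K \<epsilon> \<beta>"
      by (rule cycle) (use K in auto)
    finally show ?thesis using True by simp
  next
    case False
    have "ereal q \<le> rho_opt_N \<X> lam K \<epsilon> \<beta>" if q: "0 < q" "q < lam" for q
    proof -
      obtain M where M: "M \<in> \<X>" "absorbing_cycle M (\<lambda>j. emb (int j)) 1 q"
        using absorbing_cycle_exists[OF assms(1,2), of 1 q] q lam by auto
      then have "ereal (q powr (1 / real 1)) \<le> rho_opt_N \<X> lam K \<epsilon> \<beta>"
        using q lam K \<epsilon> \<beta>
        by (intro absorbing_cycle.rho_opt_N_ge absorbing_cycle.drift_minorization_lazy) auto
      then show ?thesis using q by simp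
    qed
    note below = this
    show ?thesis
    proof (rule dense_le_bounded[of 0])
      show "0 < ereal lam" using False lam by simp
      fix y :: ereal assume "0 < y" "y < ereal lam"
      then show "y \<le> rho_opt_N \<X> lam K \<epsilon> \<beta>"
        using below by (cases y) auto
    qed
  qed
  show ?thesis
  proof (cases "\<epsilon> < 1")
    case True
    obtain n where "alpha lam K \<epsilon> = int n" "1 \<le> n" "lam = 0 \<Longrightarrow> n = 1"
      "(1 - \<epsilon>) * (1 / lam) ^ (n - 1) + \<epsilon> \<le> K"
      using alpha_height[OF lam K \<epsilon>(1) True] by blast
    with cycle[of n] lazy True show ?thesis
      by (simp add: max_def)
  next
    case False
    then show ?thesis using lazy by simp
  qed
qed

end
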